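(* Let $0<s<d-2$. For any greedy $s$-energy sequence $\{x_n\}_{n=1}^\infty$ on $\mathbb{S}^d$, with $\omega_{N,d}=\{x_1,\dots,x_N\}$, there is a constant $c>0$ independent of $N$ such that $$\delta(\omega_{N,d})\ge c\,N^{-1/(s+1)}\qquad\text{for all } N\in\mathbb{N}.$$
   Context: $\mathbb{S}^d=\{x\in\mathbb{R}^{d+1}:\|x\|=1\}$ with $\|\cdot\|$ the Euclidean norm. For $s>0$ the Riesz $s$-kernel is $K_s(x,y)=\frac1s\|x-y\|^{-s}$ (equal to $+\infty$ on the diagonal). A greedy $s$-energy sequence $\{x_n\}_{n\ge1}$ on $\mathbb{S}^d$ is obtained by taking an arbitrary $x_1\in\mathbb{S}^d$ and, for each $N\ge1$, choosing $x_{N+1}$ to be any point of $\mathbb{S}^d$ minimizing $x\mapsto\sum_{i=1}^N K_s(x,x_i)$ over $\mathbb{S}^d$. The separation distance is $\delta(\omega_{N,d})=\min_{i\neq j}\|x_i-x_j\|$ (read as $+\infty$ if $N=1$). *)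

theory Defs
  imports "HOL-Analysis.Analysis"
begin

text \<open>The diagonal case has to be given explicitly, because \<^term>\<open>0 powr (- s) = (0::real)\<close>.\<close>

definition riesz_kernel :: "real \<Rightarrow> 'a::real_normed_vector \<Rightarrow> 'a \<Rightarrow> ereal" where
  "riesz_kernel s x y = (if x = y then \<infinity> else ereal (1 / s * norm (x - y) powr (- s)))"

text \<open>Sequences start at index 1; the value at index 0 is irrelevant.\<close>

definition greedy_energy_sequence :: "real \<Rightarrow> 'a::real_normed_vector set \<Rightarrow> (nat \<Rightarrow> 'a) \<Rightarrow> bool" where
  "greedy_energy_sequence s A x \<longleftrightarrow>
     x 1 \<in> A \<and>
     (\<forall>N\<ge>1. x (N + 1) \<in> A \<and>
        (\<forall>y\<in>A. (\<Sum>i=1..N. riesz_kernel s (x (N + 1)) (x i)) \<le> (\<Sum>i=1..N. riesz_kernel s y (x i))))"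

text \<open>Separation distance of the first \<open>N\<close> points. The minimum is over pairs of distinct indices, so
  a repeated point gives 0. For \<open>N = 1\<close> there are no such pairs and the infimum is \<open>\<infinity>\<close>.\<close>

definition separation_distance :: "(nat \<Rightarrow> 'a::real_normed_vector) \<Rightarrow> nat \<Rightarrow> ereal" where
  "separation_distance x N =
     (INF (i, j) \<in> {(i, j). i \<in> {1..N} \<and> j \<in> {1..N} \<and> i \<noteq> j}. ereal (norm (x i - x j)))"

end

theory Submission
  imports Defs
begin

text \<open>
  For \<open>s < d - 2\<close> the Riesz kernel is superharmonic near its singularity: writing \<open>u = \<parallel>z - y\<parallel>\<^sup>2\<close>,
  the spherical Laplacian in \<open>z\<close> of \<open>\<parallel>z - y\<parallel> powr (- s)\<close> equals \<open>s u powr (- s/2 - 1) (b u - a)\<close> with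
  \<open>a = d - 2 - s > 0\<close> and \<open>b = d/2 - (s + 2)/4\<close>. At a minimizer \<open>z\<close> of the potential of \<open>y\<^sub>1, \<dots>, y\<^sub>N\<close>
  the Laplacian of the potential is nonnegative, so the negative singular terms are
  compensated by the remaining ones, and \<open>\<Sum>\<^sub>i \<parallel>z - y\<^sub>i\<parallel> powr (- s - 2)\<close> is at most a constant times \<open>N\<close>.
  This gives separation of order \<open>N powr (- 1/(s + 2))\<close>, which is better than \<open>N powr (- 1/(s + 1))\<close>.
\<close>

section \<open>Calculus: the necessary second-order condition at a local minimum\<close>

lemma local_min_second_deriv_nonneg:
  fixes g g' :: "real \<Rightarrow> real"
  assumes deriv: "\<forall>\<^sub>F t in nhds x. (g has_real_derivative g' t) (at t)"
    and deriv2: "(g' has_real_derivative D) (at x)"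
    and min: "\<forall>\<^sub>F t in nhds x. g x \<le> g t"
  shows "D \<ge> 0"
proof (rule ccontr)
  assume "\<not> D \<ge> 0"
  then have "D < 0" by simp
  obtain e where e: "e > 0" "\<And>t. dist t x < e \<Longrightarrow> (g has_real_derivative g' t) (at t)"
      "\<And>t. dist t x < e \<Longrightarrow> g x \<le> g t"
    using eventually_conj[OF deriv min] by (auto simp: eventually_nhds_metric)
  have "g' x = 0"
    using DERIV_local_min[of g "g' x" x e] e by (auto simp: dist_real_def abs_minus_commute)
  \<comment> \<open>Since \<open>g' x = 0\<close>, a negative \<open>D\<close> makes
    \<open>g'\<close> negative just to the right of \<open>x\<close>, so \<open>g\<close> would
    strictly decrease there.\<close>
  obtain e' where e': "e' > 0" "\<And>h. 0 < h \<Longrightarrow> h < e' \<Longrightarrow> g' (x + h) < g' x"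
    using DERIV_neg_dec_right[OF deriv2 \<open>D < 0\<close>] by blast
  define h where "h = min e e' / 2"
  have h: "0 < h" "h < e" "h < e'" using e(1) e'(1) by (auto simp: h_def)
  have "g (x + h) < g x"
  proof (rule DERIV_neg_imp_decreasing_open[of x "x + h" g])
    fix t assume t: "x < t" "t < x + h"
    then have "(g has_real_derivative g' t) (at t)" "g' t < 0"
      using e(2)[of t] e'(2)[of "t - x"] h \<open>g' x = 0\<close> by (auto simp: dist_real_def)
    then show "\<exists>y. (g has_real_derivative y) (at t) \<and> y < 0" by blast
  next
    show "continuous_on {x..x + h} g"
    proof (rule DERIV_continuous_on)
      fix t assume "t \<in> {x..x + h}"
      then have "dist t x < e" using h by (auto simp: dist_real_def)
      then show "(g has_real_derivative g' t) (at t within {x..x + h})"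
        by (rule has_field_derivative_at_within[OF e(2)])
    qed
  qed (use h in auto)
  moreover have "g x \<le> g (x + h)" using e(3)[of "x + h"] h by (auto simp: dist_real_def)
  ultimately show False by simp
qed

section \<open>Chordal distances on the unit sphere and their powers along great circles\<close>

lemma norm_diff_unit_square:
  fixes x y :: "'a::real_inner"
  assumes "norm x = 1" "norm y = 1"
  shows "norm (x - y) ^ 2 = 2 - 2 * (x \<bullet> y)"
  using assms by (simp add: power2_norm_eq_inner inner_diff inner_commute norm_eq_1)

lemma norm_diff_unit_powr:
  fixes x y :: "'a::real_inner"
  assumes "norm x = 1" "norm y = 1"
  shows "norm (x - y) powr r = (2 - 2 * (x \<bullet> y)) powr (r / 2)"
proof -
  have "norm (x - y) = (norm (x - y) ^ 2) powr (1 / 2)"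
    by (simp add: powr_half_sqrt)
  then show ?thesis
    by (metis norm_diff_unit_square[OF assms] mult.commute powr_powr times_divide_eq_right mult.right_neutral)
qed

lemma inner_unit_less_1:
  fixes x y :: "'a::real_inner"
  assumes "norm x = 1" "norm y = 1" "x \<noteq> y"
  shows "x \<bullet> y < 1"
proof -
  have "norm (x - y) ^ 2 > 0" using assms(3) by simp
  then show ?thesis by (simp add: norm_diff_unit_square[OF assms(1,2)])
qed

text \<open>With \<open>a = z \<bullet> y\<close> and \<open>b = v \<bullet> y\<close>, the base of
  the power is the squared distance from \<open>y\<close> to the point
  \<open>cos t *\<^sub>R z + sin t *\<^sub>R v\<close> of a great circle.\<close>

lemma great_circle_powr_deriv:
  fixes a b r t :: real
  assumes "cos t * a + sin t * b < 1"
  shows "((\<lambda>t. (2 - 2 * (cos t * a + sin t * b)) powr r) has_real_derivative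
      - 2 * r * (2 - 2 * (cos t * a + sin t * b)) powr (r - 1) * (cos t * b - sin t * a)) (at t)"
proof -
  have "((\<lambda>t. 2 - 2 * (cos t * a + sin t * b)) has_real_derivative - 2 * (cos t * b - sin t * a)) (at t)"
    by (auto intro!: derivative_eq_intros)
  from DERIV_fun_powr[OF this, of r] show ?thesis
    by (rule DERIV_cong) (use assms in \<open>simp_all add: algebra_simps\<close>)
qed

text \<open>The function differentiated here is the derivative from
  \<open>great_circle_powr_deriv\<close> for \<open>r = - s / 2\<close>. The result is thus the
  second derivative at \<open>z\<close> of the \<open>- s\<close> power of the distance to
  \<open>y\<close> along the great circle.\<close>

lemma great_circle_powr_deriv2:
  fixes a b s :: real
  assumes "a < 1"
  shows "((\<lambda>t. s * (2 - 2 * (cos t * a + sin t * b)) powr (- s / 2 - 1) * (cos t * b - sin t * a))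
      has_real_derivative
      s * ((s + 2) * (2 - 2 * a) powr (- s / 2 - 2) * b\<^sup>2 - (2 - 2 * a) powr (- s / 2 - 1) * a)) (at 0)"
proof -
  have 1: "((\<lambda>t. (2 - 2 * (cos t * a + sin t * b)) powr (- s / 2 - 1)) has_real_derivative
      (s + 2) * (2 - 2 * a) powr (- s / 2 - 2) * b) (at 0)"
    using great_circle_powr_deriv[of 0 a b "- s / 2 - 1"] assms by (simp add: algebra_simps)
  have 2: "((\<lambda>t. cos t * b - sin t * a) has_real_derivative - a) (at 0)"
    by (auto intro!: derivative_eq_intros)
  show ?thesis
    using DERIV_cmult[OF DERIV_mult[OF 1 2], of s] by (simp add: power2_eq_square mult_ac)
qed

section \<open>Second variation and spherical Laplacian of the potential at a minimizer\<close>

lemma riesz_second_variation_unit: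
  fixes z v :: "'a::real_inner" and y :: "'i \<Rightarrow> 'a"
  assumes "finite I" and z: "norm z = 1" and y: "\<And>i. i \<in> I \<Longrightarrow> norm (y i) = 1" "\<And>i. i \<in> I \<Longrightarrow> y i \<noteq> z"
    and min: "\<And>w. norm w = 1 \<Longrightarrow> w \<notin> y ` I \<Longrightarrow>
        (\<Sum>i\<in>I. norm (z - y i) powr (- s)) \<le> (\<Sum>i\<in>I. norm (w - y i) powr (- s))"
    and v: "norm v = 1" "v \<bullet> z = 0" and "s > 0"
  shows "0 \<le> (\<Sum>i\<in>I. (s + 2) * (2 - 2 * (z \<bullet> y i)) powr (- s / 2 - 2) * (v \<bullet> y i)\<^sup>2
                    - (2 - 2 * (z \<bullet> y i)) powr (- s / 2 - 1) * (z \<bullet> y i))"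
proof -
  define p where "p = (\<lambda>t. cos t *\<^sub>R z + sin t *\<^sub>R v)"
  have inner_p: "p t \<bullet> w = cos t * (z \<bullet> w) + sin t * (v \<bullet> w)" for t w
    by (simp add: p_def inner_add_left)
  have norm_p: "norm (p t) = 1" for t
  proof -
    have "p t \<bullet> p t = (cos t)\<^sup>2 + (sin t)\<^sup>2"
      using z v by (simp add: p_def inner_add_left inner_add_right norm_eq_1 inner_commute power2_eq_square)
    then show ?thesis by (simp add: norm_eq_1)
  qed
  have p0: "p 0 = z" by (simp add: p_def)
  \<comment> \<open>For unit vectors, inner product below 1 means distinctness. Staying off all
    \<open>y i\<close> near parameter 0 gives both differentiability of the powers and access to
    \<open>min\<close>.\<close>
  have ev: "\<forall>\<^sub>F t in nhds 0. \<forall>i\<in>I. p t \<bullet> y i < 1"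
  proof (rule eventually_ball_finite[OF \<open>finite I\<close>], safe)
    fix i assume "i \<in> I"
    have "((\<lambda>t. p t \<bullet> y i) \<longlongrightarrow> p 0 \<bullet> y i) (nhds 0)"
      unfolding p_def by (intro tendsto_intros) (auto intro!: filterlim_ident)
    moreover have "p 0 \<bullet> y i < 1"
      unfolding p0 using \<open>i \<in> I\<close> y(2) by (intro inner_unit_less_1 z y(1)) auto
    ultimately show "\<forall>\<^sub>F t in nhds 0. p t \<bullet> y i < 1" by (rule order_tendstoD)
  qed
  define g where "g = (\<lambda>t. \<Sum>i\<in>I. (2 - 2 * (cos t * (z \<bullet> y i) + sin t * (v \<bullet> y i))) powr (- s / 2))"
  define g' where "g' = (\<lambda>t. \<Sum>i\<in>I. s * (2 - 2 * (cos t * (z \<bullet> y i) + sin t * (v \<bullet> y i))) powr (- s / 2 - 1)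
                                   * (cos t * (v \<bullet> y i) - sin t * (z \<bullet> y i)))"
  have g_eq: "g t = (\<Sum>i\<in>I. norm (p t - y i) powr (- s))" for t
    unfolding g_def by (intro sum.cong refl) (simp add: norm_diff_unit_powr norm_p y inner_p)
  have "0 \<le> (\<Sum>i\<in>I. s * ((s + 2) * (2 - 2 * (z \<bullet> y i)) powr (- s / 2 - 2) * (v \<bullet> y i)\<^sup>2
                    - (2 - 2 * (z \<bullet> y i)) powr (- s / 2 - 1) * (z \<bullet> y i)))"
  proof (rule local_min_second_deriv_nonneg)
    show "\<forall>\<^sub>F t in nhds 0. (g has_real_derivative g' t) (at t)"
      using ev
    proof eventually_elim
      case (elim t)
      show ?case unfolding g_def g'_def
      proof (rule DERIV_sum)
        fix i assume "i \<in> I"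
        then have "cos t * (z \<bullet> y i) + sin t * (v \<bullet> y i) < 1" using elim inner_p by auto
        then show "((\<lambda>t. (2 - 2 * (cos t * (z \<bullet> y i) + sin t * (v \<bullet> y i))) powr (- s / 2)) has_real_derivative
            s * (2 - 2 * (cos t * (z \<bullet> y i) + sin t * (v \<bullet> y i))) powr (- s / 2 - 1)
                                   * (cos t * (v \<bullet> y i) - sin t * (z \<bullet> y i))) (at t)"
          using great_circle_powr_deriv[of t "z \<bullet> y i" "v \<bullet> y i" "- s / 2"] by simp
      qed
    qed
    show "(g' has_real_derivative (\<Sum>i\<in>I. s * ((s + 2) * (2 - 2 * (z \<bullet> y i)) powr (- s / 2 - 2) * (v \<bullet> y i)\<^sup>2
                    - (2 - 2 * (z \<bullet> y i)) powr (- s / 2 - 1) * (z \<bullet> y i)))) (at 0)"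
      unfolding g'_def
    proof (rule DERIV_sum)
      fix i assume "i \<in> I"
      then have "z \<bullet> y i < 1" using y(2) by (intro inner_unit_less_1 z y(1)) auto
      then show "((\<lambda>t. s * (2 - 2 * (cos t * (z \<bullet> y i) + sin t * (v \<bullet> y i))) powr (- s / 2 - 1)
                       * (cos t * (v \<bullet> y i) - sin t * (z \<bullet> y i))) has_real_derivative
          s * ((s + 2) * (2 - 2 * (z \<bullet> y i)) powr (- s / 2 - 2) * (v \<bullet> y i)\<^sup>2
                    - (2 - 2 * (z \<bullet> y i)) powr (- s / 2 - 1) * (z \<bullet> y i))) (at 0)"
        using great_circle_powr_deriv2[of "z \<bullet> y i" s "v \<bullet> y i"] by simp
    qed
    show "\<forall>\<^sub>F t in nhds 0. g 0 \<le> g t"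
      using ev
    proof eventually_elim
      case (elim t)
      have "p t \<notin> y ` I" using elim norm_p[of t] by (auto simp: norm_eq_1)
      from min[OF norm_p this] show ?case by (simp only: g_eq p0)
    qed
  qed
  then have "0 \<le> s * (\<Sum>i\<in>I. (s + 2) * (2 - 2 * (z \<bullet> y i)) powr (- s / 2 - 2) * (v \<bullet> y i)\<^sup>2
                    - (2 - 2 * (z \<bullet> y i)) powr (- s / 2 - 1) * (z \<bullet> y i))"
    by (simp only: sum_distrib_left)
  then show ?thesis using \<open>s > 0\<close> by (simp add: zero_le_mult_iff)
qed

text \<open>Both terms are quadratic in \<open>v\<close>, so the unit case applied to
  \<open>sgn v\<close> rescales. Projected basis vectors need not be unit and may vanish.\<close>

lemma riesz_second_variation:
  fixes z v :: "'a::real_inner" and y :: "'i \<Rightarrow> 'a"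
  assumes "finite I" and z: "norm z = 1" and y: "\<And>i. i \<in> I \<Longrightarrow> norm (y i) = 1" "\<And>i. i \<in> I \<Longrightarrow> y i \<noteq> z"
    and min: "\<And>w. norm w = 1 \<Longrightarrow> w \<notin> y ` I \<Longrightarrow>
        (\<Sum>i\<in>I. norm (z - y i) powr (- s)) \<le> (\<Sum>i\<in>I. norm (w - y i) powr (- s))"
    and v: "v \<bullet> z = 0" and "s > 0"
  shows "0 \<le> (\<Sum>i\<in>I. (s + 2) * (2 - 2 * (z \<bullet> y i)) powr (- s / 2 - 2) * (v \<bullet> y i)\<^sup>2
                    - (2 - 2 * (z \<bullet> y i)) powr (- s / 2 - 1) * (z \<bullet> y i) * (norm v)\<^sup>2)"
proof (cases "v = 0")
  case False
  have "0 \<le> (norm v)\<^sup>2 * (\<Sum>i\<in>I. (s + 2) * (2 - 2 * (z \<bullet> y i)) powr (- s / 2 - 2) * (sgn v \<bullet> y i)\<^sup>2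
                    - (2 - 2 * (z \<bullet> y i)) powr (- s / 2 - 1) * (z \<bullet> y i))"
    using False v by (intro mult_nonneg_nonneg riesz_second_variation_unit[OF assms(1-5)] \<open>s > 0\<close>)
      (auto simp: norm_sgn sgn_div_norm)
  also have "\<dots> = (\<Sum>i\<in>I. (s + 2) * (2 - 2 * (z \<bullet> y i)) powr (- s / 2 - 2) * (v \<bullet> y i)\<^sup>2
                    - (2 - 2 * (z \<bullet> y i)) powr (- s / 2 - 1) * (z \<bullet> y i) * (norm v)\<^sup>2)"
    unfolding sum_distrib_left using False
    by (intro sum.cong refl) (simp add: sgn_div_norm power_mult_distrib field_simps)
  finally show ?thesis .
qed simp

text \<open>Adding up second variations over tangent directions gives the trace of the Hessian on
  the sphere, that is, the Laplacian of the potential divided by \<open>s\<close>.\<close>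

lemma riesz_laplacian_nonneg:
  fixes z :: "'a::euclidean_space" and y :: "'i \<Rightarrow> 'a"
  assumes "finite I" and z: "norm z = 1" and y: "\<And>i. i \<in> I \<Longrightarrow> norm (y i) = 1" "\<And>i. i \<in> I \<Longrightarrow> y i \<noteq> z"
    and min: "\<And>w. norm w = 1 \<Longrightarrow> w \<notin> y ` I \<Longrightarrow>
        (\<Sum>i\<in>I. norm (z - y i) powr (- s)) \<le> (\<Sum>i\<in>I. norm (w - y i) powr (- s))"
    and "s > 0" and d: "real DIM('a) = d + 1"
  shows "0 \<le> (\<Sum>i\<in>I. norm (z - y i) powr (- s - 2) *
                ((d / 2 - (s + 2) / 4) * (norm (z - y i))\<^sup>2 - (d - 2 - s)))"
proof -
  text \<open>Summing over the projections of the standard basis to the tangent space at \<open>z\<close>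
    avoids choosing an orthonormal basis of that space.\<close>
  define v where "v = (\<lambda>b. b - (b \<bullet> z) *\<^sub>R z)"
  have vz: "v b \<bullet> z = 0" for b
    using z by (simp add: v_def inner_diff_left norm_eq_1)
  have sum_v: "(\<Sum>b\<in>Basis. (v b \<bullet> w)\<^sup>2) = 1 - (z \<bullet> w)\<^sup>2" if "norm w = 1" for w
  proof -
    \<comment> \<open>The tangent projection is self-adjoint, so the sum is Parseval's identity for
      the tangential part of \<open>w\<close>.\<close>
    have "v b \<bullet> w = b \<bullet> (w - (z \<bullet> w) *\<^sub>R z)" for b
      by (simp add: v_def inner_diff_left inner_diff_right)
    then have "(\<Sum>b\<in>Basis. (v b \<bullet> w)\<^sup>2) = (norm (w - (z \<bullet> w) *\<^sub>R z))\<^sup>2"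
      by (subst power2_norm_eq_inner, subst euclidean_inner) (simp add: inner_commute power2_eq_square)
    also have "\<dots> = 1 - (z \<bullet> w)\<^sup>2"
      using z that unfolding power2_norm_eq_inner
      by (simp add: inner_diff_left inner_diff_right inner_commute norm_eq_1 power2_eq_square)
    finally show ?thesis .
  qed
  \<comment> \<open>This is the trace of the projection onto the tangent space.\<close>
  have sum_norm: "(\<Sum>b\<in>Basis. (norm (v b))\<^sup>2) = d"
  proof -
    have "(\<Sum>b\<in>Basis. (norm (v b))\<^sup>2) = (\<Sum>b\<in>Basis. 1 - (z \<bullet> b) * (z \<bullet> b))"
      using z unfolding power2_norm_eq_inner v_def
      by (intro sum.cong refl) (simp add: inner_diff_left inner_diff_right inner_commute norm_eq_1)
    also have "\<dots> = d + 1 - z \<bullet> z"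
      by (subst euclidean_inner[of z z]) (simp add: sum_subtractf d)
    finally show ?thesis using z by (simp add: norm_eq_1)
  qed
  have "0 \<le> (\<Sum>b\<in>Basis. \<Sum>i\<in>I. (s + 2) * (2 - 2 * (z \<bullet> y i)) powr (- s / 2 - 2) * (v b \<bullet> y i)\<^sup>2
                    - (2 - 2 * (z \<bullet> y i)) powr (- s / 2 - 1) * (z \<bullet> y i) * (norm (v b))\<^sup>2)"
    by (intro sum_nonneg riesz_second_variation assms vz)
  also have "\<dots> = (\<Sum>i\<in>I. (s + 2) * (2 - 2 * (z \<bullet> y i)) powr (- s / 2 - 2) * (1 - (z \<bullet> y i)\<^sup>2)
                    - (2 - 2 * (z \<bullet> y i)) powr (- s / 2 - 1) * (z \<bullet> y i) * d)"
    by (subst sum.swap, intro sum.cong refl)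
      (simp add: sum_subtractf y(1) flip: sum_distrib_left sum_v sum_norm)
  also have "\<dots> = (\<Sum>i\<in>I. norm (z - y i) powr (- s - 2) *
                ((d / 2 - (s + 2) / 4) * (norm (z - y i))\<^sup>2 - (d - 2 - s)))"
  proof (intro sum.cong refl)
    fix i assume i: "i \<in> I"
    \<comment> \<open>In terms of the squared distance \<open>u\<close>, the factor
      \<open>1 - (z \<bullet> y i)\<^sup>2\<close> is \<open>u - u\<^sup>2 / 4\<close>. Its factor
      \<open>u\<close> raises the exponent of the first term to that of the second, and the bracket
      becomes affine in \<open>u\<close>.\<close>
    define u where "u = 2 - 2 * (z \<bullet> y i)"
    have "u > 0" using inner_unit_less_1[OF z y(1)[OF i] y(2)[OF i, symmetric]] by (simp add: u_def)
    have t: "z \<bullet> y i = 1 - u / 2" by (simp add: u_def field_simps)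
    have "- s / 2 - 1 = (- s / 2 - 2) + 1" by simp
    then have "u powr (- s / 2 - 1) = u powr ((- s / 2 - 2) + 1)" by (rule arg_cong)
    also have "\<dots> = u powr (- s / 2 - 2) * u"
      unfolding powr_add using \<open>u > 0\<close> by simp
    finally have pw: "u powr (- s / 2 - 1) = u powr (- s / 2 - 2) * u" .
    define P where "P = u powr (- s / 2 - 2)"
    have e: "(- s - 2) / 2 = - s / 2 - 1" by (simp add: field_simps)
    show "(s + 2) * (2 - 2 * (z \<bullet> y i)) powr (- s / 2 - 2) * (1 - (z \<bullet> y i)\<^sup>2)
                    - (2 - 2 * (z \<bullet> y i)) powr (- s / 2 - 1) * (z \<bullet> y i) * d
        = norm (z - y i) powr (- s - 2) *
                ((d / 2 - (s + 2) / 4) * (norm (z - y i))\<^sup>2 - (d - 2 - s))"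
      unfolding norm_diff_unit_square[OF z y(1)[OF i]] norm_diff_unit_powr[OF z y(1)[OF i]]
        u_def[symmetric] e pw P_def[symmetric] unfolding t
      by (simp add: field_simps power2_eq_square)
  qed
  finally show ?thesis .
qed

section \<open>A bound on the singular sum, uniform over minimizers\<close>

lemma powr_absorb_lower_order:
  fixes a b q :: real
  assumes "a > 0" "b > 0" "q \<ge> 0"
  obtains C where "C > 0" "\<And>r. 0 < r \<Longrightarrow> r \<le> 2 \<Longrightarrow> r powr (- q) * (b * r\<^sup>2 - a) \<le> C - a / 2 * r powr (- q)"
proof
  \<comment> \<open>Half of \<open>a\<close> absorbs \<open>b * r\<^sup>2\<close> exactly up to the
    radius \<open>R\<close>. Beyond it the power is at most \<open>R powr (- q)\<close>, and
    \<open>r \<le> 2\<close>, the diameter of the sphere, bounds \<open>b * r\<^sup>2\<close> by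
    \<open>4 * b\<close>.\<close>
  define R where "R = sqrt (a / (2 * b))"
  have R: "R > 0" "b * R\<^sup>2 = a / 2" using assms by (auto simp: R_def)
  show "4 * b * R powr (- q) > 0" using assms R by simp
  fix r :: real assume r: "0 < r" "r \<le> 2"
  have "r powr (- q) * (b * r\<^sup>2 - a / 2) \<le> 4 * b * R powr (- q)"
  proof (cases "r \<le> R")
    case True
    then have "b * r\<^sup>2 \<le> a / 2" using r assms by (subst R(2)[symmetric]) (simp add: power_mono)
    then have "r powr (- q) * (b * r\<^sup>2 - a / 2) \<le> 0" by (simp add: mult_le_0_iff)
    also have "\<dots> \<le> 4 * b * R powr (- q)" using assms by simp
    finally show ?thesis .
  next
    case False
    have "r\<^sup>2 \<le> 2\<^sup>2" using r by (intro power_mono) auto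
    then have "b * r\<^sup>2 \<le> b * 4" using assms by (intro mult_left_mono) auto
    then have "b * r\<^sup>2 - a / 2 \<le> 4 * b" using \<open>a > 0\<close> by linarith
    moreover have "r powr (- q) \<le> R powr (- q)"
      using False R assms by (intro powr_mono2') auto
    ultimately have "r powr (- q) * (b * r\<^sup>2 - a / 2) \<le> r powr (- q) * (4 * b)"
      by (intro mult_left_mono) auto
    also have "\<dots> \<le> R powr (- q) * (4 * b)"
      using \<open>r powr (- q) \<le> R powr (- q)\<close> assms by (intro mult_right_mono) auto
    finally show ?thesis by (simp add: mult.commute)
  qed
  then show "r powr (- q) * (b * r\<^sup>2 - a) \<le> 4 * b * R powr (- q) - a / 2 * r powr (- q)"
    by (simp add: algebra_simps)
qed

text \<open>The order of quantifiers matters: one \<open>K\<close>, fixed by \<open>s\<close> and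
  the dimension, serves all configurations, hence all stages of a greedy sequence.\<close>

lemma riesz_minimizer_sum_bound:
  assumes "s > 0" and "s + 3 < real DIM('a::euclidean_space)"
  shows "\<exists>K>0. \<forall>(z::'a) (y::'i \<Rightarrow> 'a) I.
      finite I \<and> norm z = 1 \<and> (\<forall>i\<in>I. norm (y i) = 1 \<and> y i \<noteq> z) \<and>
      (\<forall>w. norm w = 1 \<and> w \<notin> y ` I \<longrightarrow>
        (\<Sum>i\<in>I. norm (z - y i) powr (- s)) \<le> (\<Sum>i\<in>I. norm (w - y i) powr (- s)))
      \<longrightarrow> (\<Sum>i\<in>I. norm (z - y i) powr (- (s + 2))) \<le> K * real (card I)"
proof -
  define d where "d = real DIM('a) - 1"
  have dim: "real DIM('a) = d + 1" by (simp add: d_def)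
  define a where "a = d - 2 - s"
  define b where "b = d / 2 - (s + 2) / 4"
  \<comment> \<open>The dimension hypothesis says \<open>s + 2 < d\<close>, which is
    \<open>a > 0\<close> and also forces \<open>b > d / 4\<close>.\<close>
  have "a > 0" "b > 0" using assms by (auto simp: a_def b_def d_def)
  obtain C where C: "C > 0"
    "\<And>r. 0 < r \<Longrightarrow> r \<le> 2 \<Longrightarrow> r powr (- (s + 2)) * (b * r\<^sup>2 - a) \<le> C - a / 2 * r powr (- (s + 2))"
    using powr_absorb_lower_order[of a b "s + 2"] \<open>a > 0\<close> \<open>b > 0\<close> \<open>s > 0\<close> by auto
  have "2 * C / a > 0" using C \<open>a > 0\<close> by simp
  moreover have "(\<Sum>i\<in>I. norm (z - y i) powr (- (s + 2))) \<le> 2 * C / a * real (card I)"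
    if fin: "finite I" and z: "norm z = 1" and y: "\<forall>i\<in>I. norm (y i) = 1 \<and> y i \<noteq> z"
      and min: "\<forall>w. norm w = 1 \<and> w \<notin> y ` I \<longrightarrow>
        (\<Sum>i\<in>I. norm (z - y i) powr (- s)) \<le> (\<Sum>i\<in>I. norm (w - y i) powr (- s))"
    for z :: 'a and y :: "'i \<Rightarrow> 'a" and I
  proof -
    have "0 \<le> (\<Sum>i\<in>I. norm (z - y i) powr (- s - 2) * (b * (norm (z - y i))\<^sup>2 - a))"
      unfolding a_def b_def
      by (rule riesz_laplacian_nonneg) (use fin z y min \<open>s > 0\<close> dim in auto)
    also have "\<dots> = (\<Sum>i\<in>I. norm (z - y i) powr (- (s + 2)) * (b * (norm (z - y i))\<^sup>2 - a))"
      by simp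
    also have "\<dots> \<le> (\<Sum>i\<in>I. C - a / 2 * norm (z - y i) powr (- (s + 2)))"
    proof (intro sum_mono C(2))
      fix i assume i: "i \<in> I"
      then show "0 < norm (z - y i)" using y by auto
      show "norm (z - y i) \<le> 2"
        using norm_triangle_ineq4[of z "y i"] z y i by simp
    qed
    also have "\<dots> = C * card I - a / 2 * (\<Sum>i\<in>I. norm (z - y i) powr (- (s + 2)))"
      by (simp add: sum_subtractf sum_distrib_left)
    finally show ?thesis using \<open>a > 0\<close> by (simp add: field_simps)
  qed
  ultimately show ?thesis by blast
qed

section \<open>Greedy sequences: new points and real-valued minimality\<close>

lemma infinite_sphere:
  fixes c :: "'a::euclidean_space"
  assumes "DIM('a) \<ge> 2" "r > 0"
  shows "infinite (sphere c r)"
proof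
  assume "finite (sphere c r)"
  \<comment> \<open>A finite connected set has at most one point, whereas a sphere contains
    antipodal pairs.\<close>
  moreover have "connected (sphere c r)" using connected_sphere[OF assms(1)] .
  ultimately have "sphere c r = {} \<or> (\<exists>x. sphere c r = {x})"
    using connected_finite_iff_sing by blast
  moreover have "c + r *\<^sub>R b \<in> sphere c r" "c - r *\<^sub>R b \<in> sphere c r" if "b \<in> Basis" for b
    using that assms(2) by (auto simp: dist_norm)
  moreover obtain b :: 'a where "b \<in> Basis" using nonempty_Basis by blast
  ultimately have "c + r *\<^sub>R b = c - r *\<^sub>R b" by (metis empty_iff singletonD)
  then have "(2 * r) *\<^sub>R b = 0" by (simp add: algebra_simps flip: scaleR_2)
  then show False using assms(2) \<open>b \<in> Basis\<close> by auto
qed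

lemma sum_riesz_kernel:
  assumes "w \<notin> y ` I"
  shows "(\<Sum>i\<in>I. riesz_kernel s w (y i)) = ereal (1 / s * (\<Sum>i\<in>I. norm (w - y i) powr (- s)))"
proof -
  have "(\<Sum>i\<in>I. riesz_kernel s w (y i)) = (\<Sum>i\<in>I. ereal (1 / s * norm (w - y i) powr (- s)))"
    using assms by (intro sum.cong refl) (auto simp: riesz_kernel_def)
  then show ?thesis by (simp only: sum_ereal sum_distrib_left)
qed

lemma greedy_energy_sequence_in:
  assumes "greedy_energy_sequence s A x" "i \<ge> 1"
  shows "x i \<in> A"
proof (cases "i = 1")
  case False
  then have "i = (i - 1) + 1" "i - 1 \<ge> 1" using assms(2) by auto
  then show ?thesis using assms(1) unfolding greedy_energy_sequence_def by metis
qed (use assms in \<open>simp add: greedy_energy_sequence_def\<close>)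

text \<open>At an earlier point the potential is infinite, while the infinite set \<open>A\<close>
  contains points where it is finite, so a minimizer never repeats. The comparison can then be made
  between real sums.\<close>

lemma greedy_energy_sequence_step:
  assumes greedy: "greedy_energy_sequence s A x" and "infinite A" "s > 0" "N \<ge> 1"
  shows "x (N + 1) \<notin> x ` {1..N}"
    and "\<And>w. w \<in> A \<Longrightarrow> w \<notin> x ` {1..N} \<Longrightarrow>
      (\<Sum>i=1..N. norm (x (N + 1) - x i) powr (- s)) \<le> (\<Sum>i=1..N. norm (w - x i) powr (- s))"
proof -
  have le: "(\<Sum>i=1..N. riesz_kernel s (x (N + 1)) (x i)) \<le> (\<Sum>i=1..N. riesz_kernel s w (x i))" if "w \<in> A" for w
    using greedy \<open>N \<ge> 1\<close> that unfolding greedy_energy_sequence_def by blast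
  show new: "x (N + 1) \<notin> x ` {1..N}"
  proof
    assume "x (N + 1) \<in> x ` {1..N}"
    then obtain j where "j \<in> {1..N}" "x (N + 1) = x j" by blast
    then have "(\<Sum>i=1..N. riesz_kernel s (x (N + 1)) (x i)) = \<infinity>"
      using \<open>s > 0\<close> by (subst sum_Pinfty) (auto simp: riesz_kernel_def)
    moreover obtain w where "w \<in> A" "w \<notin> x ` {1..N}"
      using \<open>infinite A\<close> by (meson finite_atLeastAtMost finite_imageI finite_subset subsetI)
    ultimately show False using le[of w] sum_riesz_kernel[of w x "{1..N}" s] by simp
  qed
  show "(\<Sum>i=1..N. norm (x (N + 1) - x i) powr (- s)) \<le> (\<Sum>i=1..N. norm (w - x i) powr (- s))"
    if "w \<in> A" "w \<notin> x ` {1..N}" for w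
    using le[OF that(1)] \<open>s > 0\<close> unfolding sum_riesz_kernel[OF new] sum_riesz_kernel[OF that(2)]
    by (simp add: divide_le_cancel)
qed

section \<open>From the sum bound to separation\<close>

lemma ge_powr_if_powr_le:
  fixes r q M :: real
  assumes "r > 0" "q > 0" "r powr (- q) \<le> M"
  shows "M powr (- 1 / q) \<le> r"
proof -
  have "M powr (- 1 / q) \<le> (r powr (- q)) powr (- 1 / q)"
    using assms by (intro powr_mono2') auto
  also have "\<dots> = r" using assms by (simp add: powr_powr)
  finally show ?thesis .
qed

theorem theorem1p2:
  fixes d :: nat and s :: real and x :: "nat \<Rightarrow> real ^ 'n"
  assumes "CARD('n) = d + 1"
    and "0 < s" and "s < real d - 2"
    and "greedy_energy_sequence s (sphere (0 :: real ^ 'n) 1) x"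
  shows "\<exists>c::real. c > 0 \<and>
    (\<forall>N::nat. N \<ge> 1 \<longrightarrow> separation_distance x N \<ge> ereal (c * real N powr (- 1 / (s + 1))))"
proof -
  have dim: "s + 3 < real DIM(real ^ 'n)" using assms(1,3) by simp
  have inf: "infinite (sphere (0 :: real ^ 'n) 1)"
    using assms by (intro infinite_sphere) auto
  have unit: "norm (x i) = 1" if "i \<ge> 1" for i
    using greedy_energy_sequence_in[OF assms(4) that] by simp
  obtain K where K: "K > 0" "\<forall>(z::real ^ 'n) (y::nat \<Rightarrow> real ^ 'n) I.
      finite I \<and> norm z = 1 \<and> (\<forall>i\<in>I. norm (y i) = 1 \<and> y i \<noteq> z) \<and>
      (\<forall>w. norm w = 1 \<and> w \<notin> y ` I \<longrightarrow>
        (\<Sum>i\<in>I. norm (z - y i) powr (- s)) \<le> (\<Sum>i\<in>I. norm (w - y i) powr (- s)))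
      \<longrightarrow> (\<Sum>i\<in>I. norm (z - y i) powr (- (s + 2))) \<le> K * real (card I)"
    using riesz_minimizer_sum_bound[OF \<open>0 < s\<close> dim] by blast
  \<comment> \<open>Chosen so that \<open>c * real N powr (- 1 / (s + 2))\<close> equals
    \<open>(K * real N) powr (- 1 / (s + 2))\<close>.\<close>
  define c where "c = K powr (- 1 / (s + 2))"
  have sep: "c * real N powr (- 1 / (s + 1)) \<le> norm (x j - x i)" if ij: "1 \<le> i" "i < j" "j \<le> N" for i j N
  proof -
    \<comment> \<open>The later point \<open>x j\<close> minimizes the potential of the first
      \<open>j - 1\<close> points, and \<open>x i\<close> is one of them. Its single term is bounded
      by the whole singular sum.\<close>
    define M where "M = j - 1"
    have M: "M \<ge> 1" "j = M + 1" "i \<in> {1..M}" "M \<le> N" using ij by (auto simp: M_def)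
    note step = greedy_energy_sequence_step[OF assms(4) inf \<open>0 < s\<close> M(1)]
    have new: "x k \<noteq> x j" if "k \<in> {1..M}" for k
      using step(1) that unfolding M(2) by (metis image_eqI)
    have "norm (x j - x i) powr (- (s + 2)) \<le> (\<Sum>k\<in>{1..M}. norm (x j - x k) powr (- (s + 2)))"
      using M(3) by (intro member_le_sum[where f = "\<lambda>k. norm (x j - x k) powr (- (s + 2))"]) auto
    also have "\<dots> \<le> K * real (card {1..M})"
      by (rule K(2)[rule_format]) (use step(2) unit new M(2) in auto)
    also have "\<dots> \<le> K * real N" using M(4) K(1) by simp
    finally have *: "norm (x j - x i) powr (- (s + 2)) \<le> K * real N" .
    have "x j \<noteq> x i" using new[OF M(3)] by simp
    \<comment> \<open>The bound obtained has the better exponent; as \<open>N \<ge> 1\<close>, it is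
      weakened to the required one.\<close>
    have "- 1 / (s + 1) \<le> - 1 / (s + 2)" using \<open>0 < s\<close> by (simp add: field_simps)
    then have "c * real N powr (- 1 / (s + 1)) \<le> c * real N powr (- 1 / (s + 2))"
      using ij by (intro mult_left_mono powr_mono) (auto simp: c_def)
    also have "\<dots> = (K * real N) powr (- 1 / (s + 2))"
      using K(1) by (simp add: c_def powr_mult)
    also have "\<dots> \<le> norm (x j - x i)"
      using * \<open>x j \<noteq> x i\<close> \<open>0 < s\<close> by (intro ge_powr_if_powr_le) auto
    finally show ?thesis .
  qed
  \<comment> \<open>For \<open>N \<le> 1\<close> there are no pairs and the infimum is infinite, so
    no case split on \<open>N\<close> arises.\<close>
  have "ereal (c * real N powr (- 1 / (s + 1))) \<le> separation_distance x N" for N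
    unfolding separation_distance_def
  proof (rule INF_greatest, safe)
    fix i j assume "i \<in> {1..N}" "j \<in> {1..N}" "i \<noteq> j"
    then have "c * real N powr (- 1 / (s + 1)) \<le> norm (x i - x j)"
      using sep[of i j N] sep[of j i N] by (cases "i < j") (auto simp: norm_minus_commute)
    then show "ereal (c * real N powr (- 1 / (s + 1))) \<le> ereal (norm (x i - x j))" by simp
  qed
  moreover have "c > 0" using K(1) by (simp add: c_def)
  ultimately show ?thesis by blast
qed

end
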